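(* For every integer $n\ge 1$, the set of projections $p\in M_{2n}(\mathbb{C})$ all of whose diagonal entries are equal to $1/2$ is pathwise connected.
   Context: A projection in $M_{2n}(\mathbb{C})$ is a matrix $p$ with $p=p^*=p^2$ (orthogonal projection). The set is considered with the topology inherited from $M_{2n}(\mathbb{C})$ (usual norm topology). *)

theory Defs
  imports "HOL-Analysis.Analysis"
begin

definition conj_transpose :: "complex^'n^'m \<Rightarrow> complex^'m^'n" where
  "conj_transpose A = (\<chi> i j. cnj (A $ j $ i))"

text \<open>Projection means orthogonal projection: self-adjoint as well as idempotent.\<close>

definition is_projection :: "complex^'m^'m \<Rightarrow> bool" where
  "is_projection p \<longleftrightarrow> p = conj_transpose p \<and> p = p ** p"

end

theory Submission
  imports Defs
begin

text \<open>Passing from \<open>p\<close> to \<open>u = 2 p - 1\<close>, we have to connect the self-adjoint involutions with zero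
  diagonal. Fix a set \<open>S\<close> of half of the indices and let \<open>J\<close> be the diagonal matrix with entries
  \<open>1\<close> on \<open>S\<close> and \<open>-1\<close> off \<open>S\<close>. As \<open>J\<close> and \<open>u\<close> are involutions of trace \<open>0\<close>, there is an orthonormal
  basis of vectors \<open>e\<^sub>i, f\<^sub>i\<close> with \<open>J e\<^sub>i = e\<^sub>i\<close>, \<open>J f\<^sub>i = - f\<^sub>i\<close> and
  \<open>u e\<^sub>i = l\<^sub>i e\<^sub>i + m\<^sub>i f\<^sub>i\<close>, \<open>u f\<^sub>i = m\<^sub>i e\<^sub>i - l\<^sub>i f\<^sub>i\<close>, where \<open>m\<^sub>i = sqrt (1 - l\<^sub>i\<^sup>2)\<close>.
  Replacing each \<open>l\<^sub>i\<close> by \<open>t l\<^sub>i\<close> scales the diagonal of \<open>u\<close> by \<open>t\<close>, so it stays zero; at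
  \<open>t = 0\<close> the matrix anticommutes with \<open>J\<close>. Involutions anticommuting with \<open>J\<close> automatically have
  zero diagonal, and they are connected by conjugating with complex reflections, whose unimodular
  parameter can be moved to \<open>1\<close>.\<close>

section \<open>The Hermitian inner product\<close>

definition cdot :: "complex^'m \<Rightarrow> complex^'m \<Rightarrow> complex" where
  "cdot x y = (\<Sum>i\<in>UNIV. x $ i * cnj (y $ i))"

lemma cdot_add_left: "cdot (x + y) z = cdot x z + cdot y z"
  by (simp add: cdot_def algebra_simps sum.distrib)

lemma cdot_add_right: "cdot x (y + z) = cdot x y + cdot x z"
  by (simp add: cdot_def algebra_simps sum.distrib)

lemma cdot_diff_left: "cdot (x - y) z = cdot x z - cdot y z"
  by (simp add: cdot_def algebra_simps sum_subtractf)

lemma cdot_diff_right: "cdot x (y - z) = cdot x y - cdot x z"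
  by (simp add: cdot_def algebra_simps sum_subtractf)

lemma cdot_scale_left: "cdot (c *s x) y = c * cdot x y"
  by (simp add: cdot_def sum_distrib_left mult.assoc)

lemma cdot_scale_right: "cdot x (c *s y) = cnj c * cdot x y"
  by (simp add: cdot_def sum_distrib_left algebra_simps)

lemma cdot_minus_left: "cdot (- x) y = - cdot x y"
  by (simp add: cdot_def sum_negf)

lemma cdot_minus_right: "cdot x (- y) = - cdot x y"
  by (simp add: cdot_def sum_negf)

lemma cdot_zero [simp]: "cdot 0 y = 0" "cdot x 0 = 0"
  by (simp_all add: cdot_def)

lemma cdot_sum_left: "cdot (\<Sum>p\<in>I. f p) y = (\<Sum>p\<in>I. cdot (f p) y)"
  by (induction I rule: infinite_finite_induct) (auto simp: cdot_add_left)

lemma cnj_cdot: "cnj (cdot x y) = cdot y x"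
  by (simp add: cdot_def mult.commute)

lemma Re_cdot: "Re (cdot x y) = x \<bullet> y"
  by (simp add: cdot_def inner_vec_def inner_complex_def)

lemma cdot_self: "cdot x x = of_real ((norm x)\<^sup>2)"
proof (rule complex_eqI)
  show "Re (cdot x x) = Re (of_real ((norm x)\<^sup>2))"
    by (simp add: Re_cdot power2_norm_eq_inner)
  show "Im (cdot x x) = Im (of_real ((norm x)\<^sup>2))"
    using arg_cong[OF cnj_cdot[of x x], of Im] by simp
qed

lemma cdot_axis: "cdot x (axis i 1) = x $ i" "cdot (axis i 1) x = cnj (x $ i)"
proof -
  show "cdot x (axis i 1) = x $ i"
    by (simp add: cdot_def axis_def if_distrib cong: if_cong)
  then show "cdot (axis i 1) x = cnj (x $ i)"
    by (metis cnj_cdot)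
qed

lemma cdot_axis_axis: "cdot (axis i 1) (axis j 1) = (if i = j then 1 else 0)"
  by (simp add: cdot_axis(1)) (simp add: axis_def)

lemmas cdot_simps = cdot_add_left cdot_add_right cdot_diff_left cdot_diff_right
  cdot_scale_left cdot_scale_right cdot_minus_left cdot_minus_right

lemma scaleR_eq_smult: "c *\<^sub>R (x :: complex^'m) = of_real c *s x"
  by (simp add: vec_eq_iff) (simp add: scaleR_conv_of_real)

lemma cdot_adjoint: "cdot (A *v x) y = cdot x (conj_transpose A *v y)"
proof -
  have "cdot (A *v x) y = (\<Sum>i\<in>UNIV. \<Sum>j\<in>UNIV. A $ i $ j * x $ j * cnj (y $ i))"
    by (simp add: cdot_def matrix_vector_mult_def sum_distrib_right)
  also have "\<dots> = (\<Sum>j\<in>UNIV. \<Sum>i\<in>UNIV. A $ i $ j * x $ j * cnj (y $ i))"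
    by (rule sum.swap)
  also have "\<dots> = cdot x (conj_transpose A *v y)"
    by (simp add: cdot_def matrix_vector_mult_def sum_distrib_left conj_transpose_def algebra_simps)
  finally show ?thesis .
qed

lemma matrix_vector_smult: "(A :: complex^'m^'n) *v (c *s x) = c *s (A *v x)"
  by (simp add: vec_eq_iff matrix_vector_mult_def sum_distrib_left algebra_simps)

lemma matrix_vector_sum: "(A :: complex^'m^'n) *v (\<Sum>p\<in>I. f p) = (\<Sum>p\<in>I. A *v f p)"
  by (induction I rule: infinite_finite_induct) (auto simp: matrix_vector_right_distrib)

lemma matrix_vector_minus: "(A :: complex^'m^'n) *v (- x) = - (A *v x)" "(- A) *v x = - (A *v x)"
  by (simp_all add: vec_eq_iff matrix_vector_mult_def sum_negf)

lemmas mv_simps = matrix_vector_smult matrix_vector_right_distrib matrix_vector_mult_diff_distrib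
  matrix_vector_minus matrix_vector_mult_add_rdistrib matrix_vector_mult_diff_rdistrib

lemma smult_simps:
  fixes x y :: "complex^'m"
  shows "c *s (x + y) = c *s x + c *s y" "c *s (x - y) = c *s x - c *s y" "c *s (- x) = - (c *s x)"
    "(a + b) *s x = a *s x + b *s x" "(a - b) *s x = a *s x - b *s x" "(- c) *s x = - (c *s x)"
    "a *s (b *s x) = (a * b) *s x" "1 *s x = x"
  by (simp_all add: vec_eq_iff algebra_simps)

lemma conj_transpose_mult: "conj_transpose (A ** B) = conj_transpose B ** conj_transpose A"
  by (simp add: conj_transpose_def matrix_matrix_mult_def vec_eq_iff mult.commute)

lemma matrix_eq_columns:
  fixes A B :: "complex^'m^'n"
  assumes "\<And>j. A *v axis j 1 = B *v axis j 1"
  shows "A = B"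
proof -
  have "(A *v axis j 1) $ i = A $ i $ j" for A :: "complex^'m^'n" and i j
    by (simp add: matrix_vector_mult_def axis_def if_distrib cong: if_cong)
  then show ?thesis
    using assms by (metis vec_eq_iff)
qed

section \<open>Self-adjoint involutions and extremal eigenvectors\<close>

definition sa_involution :: "complex^'m^'m \<Rightarrow> bool" where
  "sa_involution u \<longleftrightarrow> conj_transpose u = u \<and> u ** u = mat 1"

lemma sa_involution_twice: "sa_involution u \<Longrightarrow> u *v (u *v x) = x"
  by (simp add: sa_involution_def matrix_vector_mul_assoc)

lemma sa_involution_cdot: "sa_involution u \<Longrightarrow> cdot (u *v x) y = cdot x (u *v y)"
  by (metis cdot_adjoint sa_involution_def)

lemma sa_involution_isometry: "sa_involution u \<Longrightarrow> cdot (u *v x) (u *v y) = cdot x y"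
  by (simp add: sa_involution_cdot sa_involution_twice)

lemma sa_involution_uminus: "sa_involution u \<Longrightarrow> sa_involution (- u)"
  by (auto simp: sa_involution_def conj_transpose_def vec_eq_iff matrix_matrix_mult_def)

text \<open>Maximise the quadratic form on the unit sphere of \<open>V\<close>. A maximiser is an
  eigenvector, because otherwise moving it against its residual would raise the form to first order.
  The maximal value also bounds the form on all of \<open>V\<close>.\<close>

lemma rayleigh_eigenvector:
  fixes h :: "'a::euclidean_space \<Rightarrow> 'a"
  assumes h: "linear h" and V: "subspace V" and inv: "\<And>x. x \<in> V \<Longrightarrow> h x \<in> V"
    and sym: "\<And>x y. x \<in> V \<Longrightarrow> y \<in> V \<Longrightarrow> h x \<bullet> y = x \<bullet> h y"
    and nz: "\<exists>x\<in>V. x \<noteq> 0"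
  obtains v l where "v \<in> V" "norm v = 1" "h v = l *\<^sub>R v" "\<And>x. x \<in> V \<Longrightarrow> h x \<bullet> x \<le> l * (x \<bullet> x)"
proof -
  have h1: "h (x + y) = h x + h y" "h (c *\<^sub>R x) = c *\<^sub>R h x" "h (x - y) = h x - h y" for x y c
    using h by (simp_all add: linear_add linear_scale linear_diff)
  have comp: "compact (V \<inter> sphere 0 1)"
    by (intro closed_Int_compact closed_subspace V compact_sphere)
  obtain x0 where x0: "x0 \<in> V" "x0 \<noteq> 0" using nz by blast
  have "(1 / norm x0) *\<^sub>R x0 \<in> V \<inter> sphere 0 1"
    using x0 V by (simp add: subspace_scale)
  then have ne: "V \<inter> sphere 0 1 \<noteq> {}" by blast
  have "continuous_on (V \<inter> sphere 0 1) (\<lambda>x. h x \<bullet> x)"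
    by (intro continuous_intros linear_continuous_on) (use h linear_conv_bounded_linear in auto)
  from continuous_attains_sup[OF comp ne this] obtain v where
    v: "v \<in> V" "norm v = 1" and max: "\<And>y. y \<in> V \<Longrightarrow> norm y = 1 \<Longrightarrow> h y \<bullet> y \<le> h v \<bullet> v"
    by auto
  define l where "l = h v \<bullet> v"
  have le: "h x \<bullet> x \<le> l * (x \<bullet> x)" if x: "x \<in> V" for x
  proof (cases "x = 0")
    case False
    have "h ((1 / norm x) *\<^sub>R x) \<bullet> ((1 / norm x) *\<^sub>R x) \<le> l"
      unfolding l_def using x V False by (intro max) (auto simp: subspace_scale)
    then have "(h x \<bullet> x) / (norm x)\<^sup>2 \<le> l"
      by (simp add: h1 power2_eq_square)
    then show ?thesis
      using False by (simp add: pos_divide_le_eq power2_norm_eq_inner)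
  qed (simp add: linear_0[OF h])
  \<comment> \<open>The residual of the eigenvalue equation, to be shown zero by testing the bound
    at \<open>v - t *\<^sub>R w\<close>. The gain is linear in \<open>t\<close>, the possible loss
    \<open>q\<close> enters quadratically.\<close>
  define w where "w = l *\<^sub>R v - h v"
  have w: "w \<in> V" unfolding w_def using v V inv by (simp add: subspace_diff subspace_scale)
  define q where "q = l * (w \<bullet> w) - h w \<bullet> w"
  have vv: "v \<bullet> v = 1" using v by (simp add: norm_eq_1)
  have key: "2 * (w \<bullet> w) \<le> t * q" if t: "t > 0" for t
  proof -
    have "v - t *\<^sub>R w \<in> V" using v w V by (simp add: subspace_diff subspace_scale)
    from le[OF this] have "h v \<bullet> v - 2 * t * (h v \<bullet> w) + t * t * (h w \<bullet> w)
        \<le> l * (1 - 2 * t * (v \<bullet> w) + t * t * (w \<bullet> w))"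
      using sym[OF w v(1)] vv
      by (simp add: h1 inner_diff_left inner_diff_right inner_commute algebra_simps)
    then have "2 * t * (l * (v \<bullet> w) - h v \<bullet> w) \<le> t * t * q"
      unfolding q_def l_def[symmetric] by (simp add: algebra_simps)
    moreover have "l * (v \<bullet> w) - h v \<bullet> w = w \<bullet> w"
      by (metis inner_diff_left inner_scaleR_left w_def)
    ultimately have "t * (2 * (w \<bullet> w)) \<le> t * (t * q)" by (simp add: algebra_simps)
    then show ?thesis using t by simp
  qed
  have "w \<bullet> w \<le> 0"
  proof (rule ccontr)
    assume "\<not> w \<bullet> w \<le> 0"
    then have pos: "w \<bullet> w > 0" by linarith
    have "q > 0" using key[of 1] pos by linarith
    \<comment> \<open>This \<open>t\<close> would give
      \<open>2 * (w \<bullet> w) \<le> w \<bullet> w\<close>.\<close>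
    with key[of "(w \<bullet> w) / q"] pos show False by simp
  qed
  then have "w = 0" by (metis inner_gt_zero_iff not_le)
  then have "h v = l *\<^sub>R v" by (simp add: w_def)
  with v le that show thesis by blast
qed

section \<open>Pairs of involutions\<close>

text \<open>A plane invariant under both involutions, in a basis of \<open>J\<close>-eigenvectors.
  There \<open>u\<close> is a real plane reflection, and \<open>l\<close> is the cosine of its
  angle. The cases \<open>l = 1\<close> and \<open>l = -1\<close> are included: then
  \<open>e\<close> and \<open>f\<close> are eigenvectors of \<open>u\<close> with opposite
  eigenvalues.\<close>

definition dihedral_pair ::
  "complex^'m^'m \<Rightarrow> complex^'m^'m \<Rightarrow> complex^'m \<Rightarrow> complex^'m \<Rightarrow> real \<Rightarrow> bool" where
  "dihedral_pair J u e f l \<longleftrightarrow> norm e = 1 \<and> norm f = 1 \<and> J *v e = e \<and> J *v f = - f \<and> \<bar>l\<bar> \<le> 1 \<and>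
     u *v e = of_real l *s e + of_real (sqrt (1 - l\<^sup>2)) *s f \<and>
     u *v f = of_real (sqrt (1 - l\<^sup>2)) *s e - of_real l *s f"

lemma dihedral_pair_uminus_left: "dihedral_pair (- J) u e f l \<Longrightarrow> dihedral_pair J u f e (- l)"
  by (auto simp: dihedral_pair_def mv_simps smult_simps algebra_simps equation_minus_iff
      minus_equation_iff)

text \<open>The sign of \<open>f\<close> is flipped as well, which keeps the off-diagonal
  coefficient equal to the nonnegative root.\<close>

lemma dihedral_pair_uminus_right: "dihedral_pair J (- u) e f l \<Longrightarrow> dihedral_pair J u e (- f) (- l)"
  unfolding dihedral_pair_def
  by (auto simp: mv_simps smult_simps algebra_simps equation_minus_iff
      minus_equation_iff)

text \<open>The even part of \<open>u\<close> has eigenvalue \<open>l\<close> at \<open>e\<close>; normalising the odd part of \<open>u e\<close>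
  gives the partner of \<open>e\<close>.\<close>

lemma dihedral_pair_if_eigenvector:
  assumes J: "sa_involution J" and u: "sa_involution u"
    and e: "norm e = 1" "J *v e = e"
    and eig: "u *v e + J *v (u *v e) = of_real (2 * l) *s e"
  shows "u *v e = of_real l *s e \<and> \<bar>l\<bar> = 1 \<or>
    dihedral_pair J u e ((1 / sqrt (1 - l\<^sup>2)) *\<^sub>R (u *v e - l *\<^sub>R e)) l"
proof -
  define g where "g = u *v e - of_real l *s e"
  have ue: "u *v e = of_real l *s e + g" by (simp add: g_def)
  have "J *v (u *v e) = of_real (2 * l) *s e - u *v e" using eig by (simp add: algebra_simps)
  then have Jg: "J *v g = - g"
    unfolding g_def using e by (simp add: mv_simps vec_eq_iff algebra_simps)
  have ee: "cdot e e = 1" using e by (simp add: cdot_self)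
  \<comment> \<open>\<open>e\<close> is even and \<open>g\<close> is odd under \<open>J\<close>, so
    they are orthogonal.\<close>
  have "cdot (J *v g) (J *v e) = cdot g e" by (rule sa_involution_isometry[OF J])
  then have "- cdot g e = cdot g e" using Jg e by (simp add: cdot_simps)
  then have ge: "cdot g e = 0" by simp
  then have eg: "cdot e g = 0" by (metis cnj_cdot complex_cnj_zero)
  have "cdot (u *v e) (u *v e) = 1" using sa_involution_isometry[OF u] ee by simp
  then have "of_real (l\<^sup>2) + cdot g g = 1"
    unfolding ue by (simp add: cdot_simps ee ge eg power2_eq_square)
  then have "complex_of_real (l\<^sup>2 + (norm g)\<^sup>2) = of_real 1" by (simp add: cdot_self)
  then have norms: "l\<^sup>2 + (norm g)\<^sup>2 = 1" by (simp only: of_real_eq_iff)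
  have l1: "l\<^sup>2 \<le> 1" using norms zero_le_power2[of "norm g"] by linarith
  then have l1': "\<bar>l\<bar> \<le> 1" by (simp add: abs_square_le_1)
  show ?thesis
  proof (cases "g = 0")
    case True
    then have "\<bar>l\<bar> = 1" using norms by (simp add: abs_square_eq_1)
    then show ?thesis using True ue by simp
  next
    case False
    define m where "m = sqrt (1 - l\<^sup>2)"
    have mm: "m * m = 1 - l\<^sup>2" using l1 by (simp add: m_def)
    have m: "m = norm g" unfolding m_def using norms by (intro real_sqrt_unique) auto
    then have m0: "m \<noteq> 0" using False by simp
    define f where "f = (1 / m) *\<^sub>R g"
    have gf: "g = of_real m *s f" by (simp add: f_def m0 scaleR_eq_smult smult_simps)
    have nf: "norm f = 1" by (simp add: f_def m False)
    have Jf: "J *v f = - f" by (simp add: f_def scaleR_eq_smult mv_simps Jg smult_simps)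
    \<comment> \<open>Expanding \<open>u *v (u *v e)\<close> in \<open>e\<close> and
      \<open>f\<close> determines \<open>u *v f\<close>, since its coefficient \<open>m\<close> is
      nonzero.\<close>
    have "e = u *v (u *v e)" by (simp add: sa_involution_twice[OF u])
    also have "\<dots> = of_real l *s (of_real l *s e + of_real m *s f) + of_real m *s (u *v f)"
      unfolding ue by (simp add: mv_simps ue) (simp add: gf mv_simps)
    finally have "of_real m *s (u *v f) = of_real (1 - l\<^sup>2) *s e - of_real (l * m) *s f"
      by (simp add: smult_simps power2_eq_square algebra_simps)
    also have "\<dots> = of_real m *s (of_real m *s e - of_real l *s f)"
      by (simp add: mm[symmetric] smult_simps algebra_simps)
    finally have "of_real (1/m) *s (of_real m *s (u *v f)) =
        of_real (1/m) *s (of_real m *s (of_real m *s e - of_real l *s f))"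
      by simp
    then have uf: "u *v f = of_real m *s e - of_real l *s f"
      using m0 by (simp only: smult_simps) (simp add: smult_simps)
    have "f = (1 / sqrt (1 - l\<^sup>2)) *\<^sub>R (u *v e - l *\<^sub>R e)"
      by (simp add: f_def g_def m_def scaleR_eq_smult)
    moreover have "dihedral_pair J u e f l"
      unfolding dihedral_pair_def m_def[symmetric] using e nf Jf l1' uf ue gf by simp
    ultimately show ?thesis by simp
  qed
qed

definition closed_under :: "complex^'m^'m \<Rightarrow> (complex^'m) set \<Rightarrow> bool" where
  "closed_under A R \<longleftrightarrow> (\<forall>x\<in>R. A *v x \<in> R)"

lemma closed_under_uminus: "subspace R \<Longrightarrow> closed_under A R \<Longrightarrow> closed_under (- A) R"
  by (simp add: closed_under_def mv_simps subspace_neg)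

text \<open>Maximising the quadratic form of \<open>u\<close> over the even vectors of \<open>R\<close> yields an eigenvector of
  the even part of \<open>u\<close>; it has a partner unless its eigenvalue is \<open>\<plusminus>1\<close>.\<close>

lemma extremal_even_vector:
  fixes R :: "(complex^'m) set"
  assumes J: "sa_involution J" and u: "sa_involution u"
    and R: "subspace R" "closed_under J R" "closed_under u R"
    and nopair: "\<nexists>e f l. e \<in> R \<and> f \<in> R \<and> dihedral_pair J u e f l"
    and nz: "\<exists>x\<in>R. x \<noteq> 0 \<and> J *v x = x"
  obtains c v where "\<bar>c\<bar> = 1" "v \<in> R" "norm v = 1" "J *v v = v" "u *v v = of_real c *s v"
    "\<And>x. x \<in> R \<Longrightarrow> J *v x = x \<Longrightarrow> (u *v x) \<bullet> x \<le> c * (x \<bullet> x)"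
proof -
  define V where "V = R \<inter> {x. J *v x = x}"
  \<comment> \<open>On vectors fixed by \<open>J\<close> this is the even part of \<open>u\<close>,
    half of \<open>u + J u J\<close>.\<close>
  define h where "h = (\<lambda>x. (1/2) *\<^sub>R (u *v x + J *v (u *v x)))"
  have lin: "linear h"
    unfolding h_def
    by (rule linearI) (simp_all add: mv_simps scaleR_eq_smult smult_simps algebra_simps)
  have V: "subspace V"
    using R(1) unfolding V_def subspace_def
    by (auto simp: mv_simps scaleR_eq_smult)
  have inv: "h x \<in> V" if "x \<in> V" for x
    using that R unfolding V_def h_def closed_under_def
    by (auto simp: mv_simps scaleR_eq_smult[symmetric] sa_involution_twice[OF J]
        subspace_add subspace_scale)
      (simp_all add: mv_simps scaleR_eq_smult sa_involution_twice[OF J] add.commute)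
  \<comment> \<open>\<open>h x\<close> is the orthogonal projection of \<open>u *v x\<close> to the
    \<open>1\<close>-eigenspace of \<open>J\<close>, where \<open>y\<close> lies.\<close>
  have even: "h x \<bullet> y = (u *v x) \<bullet> y" if "J *v y = y" for x y
  proof -
    have "(J *v (u *v x)) \<bullet> y = (u *v x) \<bullet> y"
      using sa_involution_cdot[OF J, of "u *v x" y] that by (simp flip: Re_cdot)
    then show ?thesis by (simp add: h_def inner_add_left)
  qed
  have sym: "h x \<bullet> y = x \<bullet> h y" if "x \<in> V" "y \<in> V" for x y
  proof -
    have "h x \<bullet> y = (u *v x) \<bullet> y" using that by (auto simp: V_def even)
    also have "\<dots> = x \<bullet> (u *v y)" by (metis Re_cdot sa_involution_cdot u)
    also have "\<dots> = x \<bullet> h y" using that by (metis (mono_tags) V_def even Int_Collect inner_commute)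
    finally show ?thesis .
  qed
  have "\<exists>x\<in>V. x \<noteq> 0" using nz by (auto simp: V_def)
  from rayleigh_eigenvector[OF lin V inv sym this] obtain v l where
    v: "v \<in> V" "norm v = 1" "h v = l *\<^sub>R v" and max: "\<And>x. x \<in> V \<Longrightarrow> h x \<bullet> x \<le> l * (x \<bullet> x)"
    by blast
  have vJ: "v \<in> R" "J *v v = v" using v(1) by (auto simp: V_def)
  have "2 *\<^sub>R h v = of_real (2 * l) *s v" by (simp add: v(3) scaleR_eq_smult smult_simps)
  then have "u *v v + J *v (u *v v) = of_real (2 * l) *s v" by (simp add: h_def)
  from dihedral_pair_if_eigenvector[OF J u v(2) vJ(2) this]
  have "u *v v = of_real l *s v \<and> \<bar>l\<bar> = 1"
  proof
    assume "dihedral_pair J u v ((1 / sqrt (1 - l\<^sup>2)) *\<^sub>R (u *v v - l *\<^sub>R v)) l"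
    moreover have "(1 / sqrt (1 - l\<^sup>2)) *\<^sub>R (u *v v - l *\<^sub>R v) \<in> R"
      using vJ R by (simp add: subspace_scale subspace_diff closed_under_def)
    ultimately show ?thesis using nopair vJ by blast
  qed simp
  moreover have "(u *v x) \<bullet> x \<le> l * (x \<bullet> x)" if "x \<in> R" "J *v x = x" for x
    using max[of x] even[of x x] that by (simp add: V_def)
  ultimately show thesis using that[of l v] v(2) vJ by blast
qed

text \<open>Without a pair, the extremal eigenvalues of the even part on the \<open>1\<close>- and \<open>-1\<close>-eigenspaces of
  \<open>J\<close> are \<open>\<plusminus>1\<close>, and no eigenvalue on one side is opposite to one on the other: all four agree.\<close>

lemma constant_even_part_if_no_pair:
  fixes R :: "(complex^'m) set"
  assumes J: "sa_involution J" and u: "sa_involution u"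
    and R: "subspace R" "closed_under J R" "closed_under u R"
    and nopair: "\<nexists>e f l. e \<in> R \<and> f \<in> R \<and> dihedral_pair J u e f l"
    and nz: "\<exists>x\<in>R. x \<noteq> 0 \<and> J *v x = x" "\<exists>x\<in>R. x \<noteq> 0 \<and> J *v x = - x"
  obtains c where "\<bar>c\<bar> = 1"
    "\<And>x. x \<in> R \<Longrightarrow> (u *v x) \<bullet> x + (u *v (J *v x)) \<bullet> (J *v x) = 2 * c * (x \<bullet> x)"
proof -
  note un = sa_involution_uminus[OF u] and Jn = sa_involution_uminus[OF J]
    and Run = closed_under_uminus[OF R(1) R(3)] and RJn = closed_under_uminus[OF R(1) R(2)]
  \<comment> \<open>Negating \<open>u\<close> turns maxima into minima, negating \<open>J\<close>
    exchanges its eigenspaces, and neither creates a pair. So the extremal vectors exist in all four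
    cases.\<close>
  have np2: "\<nexists>e f l. e \<in> R \<and> f \<in> R \<and> dihedral_pair J (- u) e f l"
    using nopair dihedral_pair_uminus_right subspace_neg[OF R(1)] by metis
  have np3: "\<nexists>e f l. e \<in> R \<and> f \<in> R \<and> dihedral_pair (- J) u e f l"
    using nopair dihedral_pair_uminus_left by metis
  have np4: "\<nexists>e f l. e \<in> R \<and> f \<in> R \<and> dihedral_pair (- J) (- u) e f l"
    using np2 dihedral_pair_uminus_left by metis
  have nz': "\<exists>x\<in>R. x \<noteq> 0 \<and> (- J) *v x = x"
    using nz(2) by (auto simp: mv_simps equation_minus_iff)
  obtain c1 v1 where 1: "\<bar>c1\<bar> = 1" "v1 \<in> R" "norm v1 = 1" "J *v v1 = v1"
    "u *v v1 = of_real c1 *s v1"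
    "\<And>x. x \<in> R \<Longrightarrow> J *v x = x \<Longrightarrow> (u *v x) \<bullet> x \<le> c1 * (x \<bullet> x)"
    using extremal_even_vector[OF J u R nopair nz(1)] by metis
  obtain c2 v2 where 2: "\<bar>c2\<bar> = 1" "v2 \<in> R" "norm v2 = 1" "J *v v2 = v2"
    "(- u) *v v2 = of_real c2 *s v2"
    "\<And>x. x \<in> R \<Longrightarrow> J *v x = x \<Longrightarrow> ((- u) *v x) \<bullet> x \<le> c2 * (x \<bullet> x)"
    using extremal_even_vector[OF J un R(1,2) Run np2 nz(1)] by metis
  obtain c3 v3 where 3: "\<bar>c3\<bar> = 1" "v3 \<in> R" "norm v3 = 1" "(- J) *v v3 = v3"
    "u *v v3 = of_real c3 *s v3"
    "\<And>x. x \<in> R \<Longrightarrow> (- J) *v x = x \<Longrightarrow> (u *v x) \<bullet> x \<le> c3 * (x \<bullet> x)"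
    using extremal_even_vector[OF Jn u R(1) RJn R(3) np3 nz'] by metis
  obtain c4 v4 where 4: "\<bar>c4\<bar> = 1" "v4 \<in> R" "norm v4 = 1" "(- J) *v v4 = v4"
    "(- u) *v v4 = of_real c4 *s v4"
    "\<And>x. x \<in> R \<Longrightarrow> (- J) *v x = x \<Longrightarrow> ((- u) *v x) \<bullet> x \<le> c4 * (x \<bullet> x)"
    using extremal_even_vector[OF Jn un R(1) RJn Run np4 nz'] by metis
  \<comment> \<open>An even and an odd eigenvector of \<open>u\<close> with opposite eigenvalues of
    modulus \<open>1\<close> are already a pair, with off-diagonal coefficient
    \<open>0\<close>.\<close>
  have clash: "c \<noteq> - d" if "\<bar>c\<bar> = 1" "e \<in> R" "norm e = 1" "J *v e = e" "u *v e = of_real c *s e"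
    "f \<in> R" "norm f = 1" "(- J) *v f = f" "u *v f = of_real d *s f" for c d e f
  proof
    assume "c = - d"
    moreover from that(1) have "c\<^sup>2 = 1" by (simp add: abs_square_eq_1)
    ultimately have "dihedral_pair J u e f c"
      using that unfolding dihedral_pair_def by (simp add: mv_simps smult_simps minus_equation_iff)
    then show False using nopair that by blast
  qed
  have v2: "u *v v2 = of_real (- c2) *s v2" and v4: "u *v v4 = of_real (- c4) *s v4"
    using 2(5) 4(5) by (simp_all add: mv_simps smult_simps) (metis minus_minus)+
  have "c1 \<noteq> - c3" "c1 \<noteq> c4" "- c2 \<noteq> - c3"
    using clash[OF 1(1-5) 3(2-5)] clash[OF 1(1-5) 4(2-4) v4] clash[OF _ 2(2-4) v2 3(2-5)] 2(1)
    by auto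
  \<comment> \<open>All four values are signs, so three exclusions leave only one choice. The upper
    and lower bounds for the form then coincide on each eigenspace.\<close>
  then have c: "c3 = c1" "c4 = - c1" "c2 = - c1"
    using 1(1) 2(1) 3(1) 4(1) by (auto simp: abs_if split: if_splits)
  have S: "(u *v x) \<bullet> x = c1 * (x \<bullet> x)" if "x \<in> R" "J *v x = x" for x
    using 1(6)[OF that] 2(6)[OF that] c by (simp add: mv_simps)
  have T: "(u *v x) \<bullet> x = c1 * (x \<bullet> x)" if "x \<in> R" "J *v x = - x" for x
    using 3(6)[of x] 4(6)[of x] that c by (simp add: mv_simps)
  have "(u *v x) \<bullet> x + (u *v (J *v x)) \<bullet> (J *v x) = 2 * c1 * (x \<bullet> x)" if x: "x \<in> R" for x
  proof -
    define y where "y = (1/2) *\<^sub>R (x + J *v x)"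
    define z where "z = (1/2) *\<^sub>R (x - J *v x)"
    have xyz: "x = y + z" "J *v x = y - z"
      unfolding y_def z_def by (simp_all add: algebra_simps flip: scaleR_add_left)
    have Jx: "J *v x \<in> R" using x R by (simp add: closed_under_def)
    have yz: "y \<in> R" "z \<in> R"
      using x Jx R(1) by (simp_all add: y_def z_def subspace_add subspace_diff subspace_scale)
    have "J *v y = y" "J *v z = - z"
      by (simp_all add: y_def z_def scaleR_eq_smult mv_simps smult_simps sa_involution_twice[OF J])
    then have yz': "(u *v y) \<bullet> y = c1 * (y \<bullet> y)" "(u *v z) \<bullet> z = c1 * (z \<bullet> z)"
      using S T yz by blast+
    have "x \<bullet> x = (J *v x) \<bullet> (J *v x)" by (metis J Re_cdot sa_involution_isometry)
    then have xx: "x \<bullet> x = y \<bullet> y + z \<bullet> z"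
      unfolding xyz(2)
        by (subst (asm) (1 2) xyz(1)) (subst (1 2) xyz(1), simp add: inner_simps inner_commute)
    \<comment> \<open>The terms mixing \<open>y\<close> and \<open>z\<close> have opposite signs at
      \<open>x\<close> and \<open>J *v x\<close> and cancel.\<close>
    have "(u *v x) \<bullet> x + (u *v (J *v x)) \<bullet> (J *v x) = 2 * ((u *v y) \<bullet> y) + 2 * ((u *v z) \<bullet> z)"
      unfolding xyz(2) by (subst (1 2) xyz(1)) (simp add: mv_simps inner_simps algebra_simps)
    then show ?thesis unfolding yz' xx by (simp add: algebra_simps)
  qed
  then show thesis using that 1(1) by blast
qed

section \<open>Orthonormal families and traces on their complements\<close>

definition orthonormal :: "'i set \<Rightarrow> ('i \<Rightarrow> complex^'m) \<Rightarrow> bool" where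
  "orthonormal I g \<longleftrightarrow> (\<forall>p\<in>I. \<forall>q\<in>I. cdot (g p) (g q) = (if p = q then 1 else 0))"

definition orth_compl :: "'i set \<Rightarrow> ('i \<Rightarrow> complex^'m) \<Rightarrow> (complex^'m) set" where
  "orth_compl I g = {x. \<forall>p\<in>I. cdot x (g p) = 0}"

definition orth_proj :: "'i set \<Rightarrow> ('i \<Rightarrow> complex^'m) \<Rightarrow> complex^'m \<Rightarrow> complex^'m" where
  "orth_proj I g x = x - (\<Sum>p\<in>I. cdot x (g p) *s g p)"

lemma orth_proj_in_compl:
  assumes "finite I" "orthonormal I g"
  shows "orth_proj I g x \<in> orth_compl I g"
proof -
  have "(\<Sum>q\<in>I. cdot x (g q) * cdot (g q) (g p)) = cdot x (g p)" if p: "p \<in> I" for p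
  proof -
    have "(\<Sum>q\<in>I. cdot x (g q) * cdot (g q) (g p)) = (\<Sum>q\<in>I. if q = p then cdot x (g q) else 0)"
      using assms(2) p by (intro sum.cong) (auto simp: orthonormal_def)
    then show ?thesis using assms(1) p by simp
  qed
  then show ?thesis
    by (simp add: orth_proj_def orth_compl_def cdot_simps cdot_sum_left)
qed

lemma subspace_orth_compl: "subspace (orth_compl I g)"
  by (auto simp: subspace_def orth_compl_def cdot_simps scaleR_eq_smult)

lemma cdot_orth_proj_right:
  assumes "y \<in> orth_compl I g"
  shows "cdot y (orth_proj I g x) = cdot y x"
proof -
  have "cdot (\<Sum>p\<in>I. cdot x (g p) *s g p) y = 0"
    using assms unfolding cdot_sum_left
    by (intro sum.neutral) (metis (mono_tags, lifting) cdot_scale_left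
        cnj_cdot complex_cnj_zero mem_Collect_eq mult_zero_right orth_compl_def)
  then have "cdot y (\<Sum>p\<in>I. cdot x (g p) *s g p) = 0" by (metis cnj_cdot complex_cnj_zero)
  then show ?thesis by (simp add: orth_proj_def cdot_diff_right)
qed

lemma orthonormal_expansion:
  assumes "finite I" "orthonormal I g" "orth_compl I g \<subseteq> {0}"
  shows "x = (\<Sum>p\<in>I. cdot x (g p) *s g p)"
  using orth_proj_in_compl[OF assms(1,2), of x] assms(3) by (auto simp: orth_proj_def)

text \<open>Both sides are the trace of the compression of \<open>A\<close> to the orthogonal complement.\<close>

lemma trace_orth_compl:
  fixes A :: "complex^'m^'m"
  assumes "finite I" "orthonormal I g" "closed_under A (orth_compl I g)"
  shows "(\<Sum>i\<in>UNIV. cdot (A *v orth_proj I g (axis i 1)) (orth_proj I g (axis i 1))) =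
    trace A - (\<Sum>p\<in>I. cdot (A *v g p) (g p))"
proof -
  have "(\<Sum>i\<in>UNIV. cdot (A *v orth_proj I g (axis i 1)) (orth_proj I g (axis i 1)))
      = (\<Sum>i\<in>UNIV. (A *v orth_proj I g (axis i 1)) $ i)"
    using assms orth_proj_in_compl[OF assms(1,2)]
    by (simp add: cdot_orth_proj_right closed_under_def cdot_axis)
  also have "\<dots> = (\<Sum>i\<in>UNIV. A $ i $ i - (\<Sum>p\<in>I. cnj (g p $ i) * (A *v g p) $ i))"
    by (simp add: orth_proj_def mv_simps matrix_vector_sum cdot_axis matrix_vector_mul_component)
      (simp add: inner_axis matrix_vector_mult_def axis_def if_distrib cong: if_cong)
  also have "\<dots> = trace A - (\<Sum>p\<in>I. \<Sum>i\<in>UNIV. cnj (g p $ i) * (A *v g p) $ i)"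
    unfolding sum_subtractf trace_def by (subst sum.swap) simp
  finally show ?thesis by (simp add: cdot_def mult.commute)
qed

text \<open>The sum in the assumption is the trace of the projection to the complement. If it is
  zero, every basis vector projects to \<open>0\<close>, so all coordinates of a vector in the
  complement vanish.\<close>

lemma orth_compl_trivial:
  assumes "finite I" "orthonormal I g"
    and "(\<Sum>i\<in>UNIV. (norm (orth_proj I g (axis i 1)))\<^sup>2) = 0"
  shows "orth_compl I g \<subseteq> {0}"
proof
  fix x assume x: "x \<in> orth_compl I g"
  have 0: "orth_proj I g (axis i 1) = 0" for i
    using assms(3) by (simp add: sum_nonneg_eq_0_iff)
  have "x $ i = 0" for i
    using cdot_orth_proj_right[OF x, of "axis i 1"] 0 by (simp add: cdot_axis)
  then show "x \<in> {0}" by (simp add: vec_eq_iff)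
qed

section \<open>Complete systems of pairs\<close>

definition sgn_bool :: "bool \<Rightarrow> real" where "sgn_bool b = (if b then 1 else -1)"

lemma sgn_bool_simps [simp]: "sgn_bool b * sgn_bool b = 1" "sgn_bool (\<not> b) = - sgn_bool b"
  "sgn_bool True = 1" "sgn_bool False = -1"
  "sgn_bool b * (sgn_bool b * x) = x"
    "of_real (sgn_bool b) * (of_real (sgn_bool b) * y) = (y :: complex)"
  "of_real (sgn_bool b) * of_real (sgn_bool b) = (1 :: complex)"
  by (auto simp: sgn_bool_def)

text \<open>The flag records the \<open>J\<close>-eigenvalue: \<open>True\<close> for the even
  vector of a pair, \<open>False\<close> for the odd one.\<close>

definition pair_index :: "nat \<Rightarrow> (nat \<times> bool) set" where "pair_index k = {..<k} \<times> UNIV"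

lemma finite_pair_index [simp]: "finite (pair_index k)" by (simp add: pair_index_def)

lemma sum_pair_index: "(\<Sum>p\<in>pair_index k. f p) = (\<Sum>i<k. f (i, True) + f (i, False))"
  unfolding pair_index_def sum.cartesian_product' by (simp add: UNIV_bool add.commute)

definition dihedral_system ::
  "complex^'m^'m \<Rightarrow> complex^'m^'m \<Rightarrow> nat \<Rightarrow> (nat \<times> bool \<Rightarrow> complex^'m) \<Rightarrow> (nat \<Rightarrow> real) \<Rightarrow> bool" where
  "dihedral_system J u k g l \<longleftrightarrow> orthonormal (pair_index k) g \<and>
    (\<forall>i<k. dihedral_pair J u (g (i, True)) (g (i, False)) (l i))"

lemma dihedral_system_J:
  assumes "dihedral_system J u k g l" "i < k"
  shows "J *v g (i, b) = of_real (sgn_bool b) *s g (i, b)"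
  using assms by (cases b) (auto simp: dihedral_system_def dihedral_pair_def smult_simps)

lemma dihedral_system_u:
  assumes "dihedral_system J u k g l" "i < k"
  shows "u *v g (i, b) = of_real (sgn_bool b * l i) *s g (i, b)
    + of_real (sqrt (1 - (l i)\<^sup>2)) *s g (i, \<not> b)"
  using assms by (cases b) (auto simp: dihedral_system_def dihedral_pair_def smult_simps)

text \<open>Both involutions preserve the span of the system; being self-adjoint, they preserve its
  complement.\<close>

lemma closed_under_orth_compl:
  assumes sys: "dihedral_system J u k g l" and J: "sa_involution J" and u: "sa_involution u"
  shows "closed_under J (orth_compl (pair_index k) g)"
    "closed_under u (orth_compl (pair_index k) g)"
  unfolding closed_under_def orth_compl_def
  by (auto simp: pair_index_def sa_involution_cdot[OF J] sa_involution_cdot[OF u] cdot_simps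
      dihedral_system_J[OF sys] dihedral_system_u[OF sys])

lemma dihedral_system_extend:
  assumes sys: "dihedral_system J u k g l" and J: "sa_involution J"
    and e: "e \<in> orth_compl (pair_index k) g" and f: "f \<in> orth_compl (pair_index k) g"
    and pair: "dihedral_pair J u e f m"
  shows "dihedral_system J u (Suc k) (g((k, True) := e, (k, False) := f)) (l(k := m))"
proof -
  \<comment> \<open>Eigenvectors of \<open>J\<close> for different eigenvalues are
    orthogonal.\<close>
  have "cdot (J *v e) (J *v f) = cdot e f" by (rule sa_involution_isometry[OF J])
  then have ef: "cdot e f = 0" using pair by (simp add: dihedral_pair_def cdot_simps)
  then have fe: "cdot f e = 0" by (metis cnj_cdot complex_cnj_zero)
  have ee: "cdot e e = 1" "cdot f f = 1" using pair by (simp_all add: dihedral_pair_def cdot_self)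
  have eg: "cdot e (g (i, b)) = 0" "cdot f (g (i, b)) = 0" if "i < k" for i b
    using e f that by (auto simp: orth_compl_def pair_index_def)
  then have ge: "cdot (g (i, b)) e = 0" "cdot (g (i, b)) f = 0" if "i < k" for i b
    using that by (metis cnj_cdot complex_cnj_zero)+
  have gg: "cdot (g (i, b)) (g (j, c)) = (if (i, b) = (j, c) then 1 else 0)" if "i < k"
    "j < k" for i j b c
    using sys that by (auto simp: dihedral_system_def orthonormal_def pair_index_def)
  have "orthonormal (pair_index (Suc k)) (g((k, True) := e, (k, False) := f))"
    unfolding orthonormal_def pair_index_def
    by (auto simp: ef fe ee eg ge gg less_Suc_eq)
  then show ?thesis
    using sys pair unfolding dihedral_system_def by (auto simp: less_Suc_eq)
qed

text \<open>A trace argument on the complement \<open>R\<close>. Each pair contributes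
  \<open>0\<close> to the traces of \<open>J\<close>, \<open>u\<close> and \<open>J u J\<close>, so
  all three have trace \<open>0\<close> on \<open>R\<close>. For \<open>J\<close> this makes both
  eigenspaces in \<open>R\<close> nonzero. Without a further pair, \<open>u + J u J\<close> would
  act on \<open>R\<close> with quadratic form \<open>2 * c\<close> times the squared norm, which has
  nonzero trace.\<close>

lemma dihedral_system_step:
  fixes J u :: "complex^'m^'m"
  assumes J: "sa_involution J" and u: "sa_involution u"
    and tr: "trace J = 0" "trace u = 0"
    and sys: "dihedral_system J u k g l"
    and nz: "\<not> orth_compl (pair_index k) g \<subseteq> {0}"
  shows "\<exists>g' l'. dihedral_system J u (Suc k) g' l'"
proof (rule ccontr)
  define R where "R = orth_compl (pair_index k) g"
  \<comment> \<open>Summing \<open>(A *v q i) \<bullet> q i\<close> over \<open>i\<close> yields the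
    real part of the trace of \<open>A\<close> compressed to \<open>R\<close>.\<close>
  define q where "q i = orth_proj (pair_index k) g (axis i 1)" for i
  note on = sys[unfolded dihedral_system_def, THEN conjunct1]
  assume no: "\<not> ?thesis"
  then have np: "\<nexists>e f l. e \<in> R \<and> f \<in> R \<and> dihedral_pair J u e f l"
    using dihedral_system_extend[OF sys J] unfolding R_def by blast
  have R: "subspace R" "closed_under J R" "closed_under u R"
    unfolding R_def using closed_under_orth_compl[OF sys J u] subspace_orth_compl by auto
  have q: "q i \<in> R" for i unfolding q_def R_def using on by (simp add: orth_proj_in_compl)
  have gg: "cdot (g (i, b)) (g (i, c)) = (if b = c then 1 else 0)" if "i < k" for i b c
    using on that by (auto simp: orthonormal_def pair_index_def)
  have pos: "(\<Sum>i\<in>UNIV. q i \<bullet> q i) \<noteq> 0"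
    using orth_compl_trivial[OF finite_pair_index on] nz by (auto simp: q_def power2_norm_eq_inner)
  have tr0: "(\<Sum>i\<in>UNIV. (A *v q i) \<bullet> q i) = 0"
    if "closed_under A R" "trace A = 0"
      "\<And>i. i < k \<Longrightarrow> cdot (A *v g (i, True)) (g (i, True)) +
        cdot (A *v g (i, False)) (g (i, False)) = 0" for A
  proof -
    have "(\<Sum>i\<in>UNIV. cdot (A *v q i) (q i)) = 0"
      using trace_orth_compl[OF finite_pair_index on that(1)[unfolded R_def]] that(2,3)
      by (simp add: q_def sum_pair_index)
    then show ?thesis by (simp flip: Re_cdot Re_sum)
  qed
  have trJ: "(\<Sum>i\<in>UNIV. (J *v q i) \<bullet> q i) = 0"
    by (rule tr0[OF R(2) tr(1)]) (simp add: dihedral_system_J[OF sys] cdot_simps gg)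
  have tru: "(\<Sum>i\<in>UNIV. (u *v q i) \<bullet> q i) = 0"
    by (rule tr0[OF R(3) tr(2)]) (simp add: dihedral_system_u[OF sys] cdot_simps gg)
  have "(\<Sum>i\<in>UNIV. ((J ** u ** J) *v q i) \<bullet> q i) = 0"
  proof (rule tr0)
    show "closed_under (J ** u ** J) R"
      using R by (simp add: closed_under_def flip: matrix_vector_mul_assoc)
    have "trace (J ** u ** J) = trace (u ** (J ** J))"
      by (metis matrix_mul_assoc trace_mul_sym)
    then show "trace (J ** u ** J) = 0" using J tr by (simp add: sa_involution_def)
  qed (simp flip: matrix_vector_mul_assoc
        add: sa_involution_cdot[OF J] dihedral_system_J[OF sys] mv_simps dihedral_system_u[OF sys]
        cdot_simps gg)
  then have trJuJ: "(\<Sum>i\<in>UNIV. (u *v (J *v q i)) \<bullet> (J *v q i)) = 0"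
    by (simp flip: matrix_vector_mul_assoc Re_cdot add: sa_involution_cdot[OF J])
  \<comment> \<open>If \<open>R\<close> had no nonzero even vector, \<open>J\<close> would be
    \<open>-1\<close> on every \<open>q i\<close>, contradicting its zero trace on \<open>R\<close>.
    The odd case is symmetric.\<close>
  have nzS: "\<exists>x\<in>R. x \<noteq> 0 \<and> J *v x = x"
  proof (rule ccontr)
    assume no: "\<not> ?thesis"
    have "q i + J *v q i = 0" for i
    proof -
      have "q i + J *v q i \<in> R" using q R by (simp add: subspace_add closed_under_def)
      moreover have "J *v (q i + J *v q i) = q i + J *v q i"
        by (simp add: mv_simps sa_involution_twice[OF J])
      ultimately show ?thesis using no by blast
    qed
    then have "J *v q i = - q i" for i by (metis add_eq_0_iff)
    then show False using trJ pos by (simp add: sum_negf)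
  qed
  have nzT: "\<exists>x\<in>R. x \<noteq> 0 \<and> J *v x = - x"
  proof (rule ccontr)
    assume no: "\<not> ?thesis"
    have "q i - J *v q i = 0" for i
    proof -
      have "q i - J *v q i \<in> R" using q R by (simp add: subspace_diff closed_under_def)
      moreover have "J *v (q i - J *v q i) = - (q i - J *v q i)"
        by (simp add: mv_simps sa_involution_twice[OF J])
      ultimately show ?thesis using no by blast
    qed
    then have "J *v q i = q i" for i by simp
    then show False using trJ pos by simp
  qed
  obtain c where "\<bar>c\<bar> = 1"
    and c: "\<And>x. x \<in> R \<Longrightarrow> (u *v x) \<bullet> x + (u *v (J *v x)) \<bullet> (J *v x) = 2 * c * (x \<bullet> x)"
    using constant_even_part_if_no_pair[OF J u R np nzS nzT] by blast
  have "(\<Sum>i\<in>UNIV. 2 * c * (q i \<bullet> q i)) = 0"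
    unfolding c[OF q, symmetric] sum.distrib tru trJuJ by simp
  then show False using \<open>\<bar>c\<bar> = 1\<close> pos by (simp flip: sum_distrib_left)
qed

text \<open>The trace of the identity on the complement equals \<open>CARD('m) - 2 * k\<close> and
  is a sum of squared norms.\<close>

lemma dihedral_system_bound:
  fixes g :: "nat \<times> bool \<Rightarrow> complex^'m"
  assumes "dihedral_system J u k g l"
  shows "2 * k \<le> CARD('m)"
proof -
  note on = assms[unfolded dihedral_system_def, THEN conjunct1]
  have gg: "cdot (g p) (g p) = 1" if "p \<in> pair_index k" for p
    using on that by (auto simp: orthonormal_def)
  define s where "s = (\<Sum>i\<in>UNIV. (norm (orth_proj (pair_index k) g (axis i 1)))\<^sup>2)"
  have "closed_under (mat 1) (orth_compl (pair_index k) g)" by (simp add: closed_under_def)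
  from trace_orth_compl[OF finite_pair_index on this]
  have "complex_of_real s = of_nat CARD('m) - of_nat (card (pair_index k))"
    by (simp add: s_def gg trace_I cdot_self[of "orth_proj I h y" for I h y])
  from arg_cong[OF this, of Re] have "s = real CARD('m) - real (card (pair_index k))" by simp
  moreover have "s \<ge> 0" by (simp add: s_def sum_nonneg)
  ultimately show ?thesis by (simp add: pair_index_def card_cartesian_product)
qed

lemma complete_dihedral_system:
  fixes J u :: "complex^'m^'m"
  assumes "sa_involution J" "sa_involution u" "trace J = 0" "trace u = 0"
  obtains k g l where "dihedral_system J u k g l" "orth_compl (pair_index k) g \<subseteq> {0}"
proof (rule ccontr)
  assume "\<not> thesis"
  then have no: "\<not> orth_compl (pair_index k) g \<subseteq> {0}" if "dihedral_system J u k g l" for k g l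
    using that \<open>\<And>k g l. dihedral_system J u k g l \<Longrightarrow> orth_compl (pair_index k) g \<subseteq> {0} \<Longrightarrow> thesis\<close>
      by blast
  have "\<exists>g l. dihedral_system J u k g l" for k
  proof (induction k)
    case 0
    show ?case by (simp add: dihedral_system_def orthonormal_def pair_index_def)
  next
    case (Suc k)
    then show ?case using dihedral_system_step[OF assms] no by blast
  qed
  \<comment> \<open>That many pairs would need twice the available dimension.\<close>
  from this[of "CARD('m)"] obtain g l where "dihedral_system J u CARD('m) g l" by blast
  from dihedral_system_bound[OF this] show False by simp
qed

section \<open>Contracting the even part\<close>

definition sgn_mat :: "'m set \<Rightarrow> complex^'m^'m" where
  "sgn_mat S = (\<chi> x y. if x = y then of_real (sgn_bool (x \<in> S)) else 0)"

lemma sgn_mat_vec: "(sgn_mat S *v x) $ i = of_real (sgn_bool (i \<in> S)) * x $ i"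
  by (simp add: sgn_mat_def matrix_vector_mult_def if_distrib[of "\<lambda>c. c * _"] cong: if_cong)

lemma sgn_mat_mult_left: "(sgn_mat S ** A) $ i $ j = of_real (sgn_bool (i \<in> S)) * A $ i $ j"
  by (simp add: sgn_mat_def matrix_matrix_mult_def if_distrib[of "\<lambda>c. c * _"] cong: if_cong)

lemma sgn_mat_mult_right: "(A ** sgn_mat S) $ i $ j = of_real (sgn_bool (j \<in> S)) * A $ i $ j"
  by (simp add: sgn_mat_def matrix_matrix_mult_def if_distrib cong: if_cong)

lemma sa_involution_sgn_mat: "sa_involution (sgn_mat S)"
  unfolding sa_involution_def
  by (auto simp: vec_eq_iff sgn_mat_mult_left conj_transpose_def)
    (auto simp: sgn_mat_def mat_def)

lemma trace_sgn_mat: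
  fixes S :: "'m::finite set"
  assumes "CARD('m) = 2 * card S"
  shows "trace (sgn_mat S :: complex^'m^'m) = 0"
proof -
  have "trace (sgn_mat S :: complex^'m^'m) = (\<Sum>i\<in>UNIV. of_real (sgn_bool (i \<in> S)))"
    by (simp add: trace_def sgn_mat_def)
  also have "\<dots> = (\<Sum>i\<in>S. 1) + (\<Sum>i\<in>- S. - 1)"
    unfolding Compl_eq_Diff_UNIV
    by (subst sum.subset_diff[of S UNIV])
      (auto simp: sgn_bool_def intro!: sum.cong arg_cong2[where f="(+)"])
  also have "\<dots> = of_nat (card S) - of_nat (card (- S))" by simp
  also have "\<dots> = 0"
    using assms by (simp add: Compl_eq_Diff_UNIV card_Diff_subset of_nat_diff card_mono)
  finally show ?thesis .
qed

definition hollow_involutions :: "(complex^'m^'m) set" where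
  "hollow_involutions = {u. sa_involution u \<and> (\<forall>i. u $ i $ i = 0)}"

definition odd_involutions :: "'m set \<Rightarrow> (complex^'m^'m) set" where
  "odd_involutions S = {u. sa_involution u \<and> sgn_mat S ** u = - (u ** sgn_mat S)}"

text \<open>A diagonal entry of \<open>u\<close> is multiplied by the same sign from the left and
  from the right, so anticommutation makes it equal to its negative.\<close>

lemma odd_involutions_subset:
  fixes S :: "'m::finite set"
  shows "odd_involutions S \<subseteq> hollow_involutions"
proof
  fix u assume "u \<in> odd_involutions S"
  then have u: "sa_involution u" and d: "\<And>i. (sgn_mat S ** u) $ i $ i = - (u ** sgn_mat S) $ i $ i"
    by (auto simp: odd_involutions_def)
  have "u $ i $ i = 0" for i
    using d[of i] by (auto simp: sgn_mat_mult_left sgn_mat_mult_right sgn_bool_def split: if_splits)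
  with u show "u \<in> hollow_involutions" by (simp add: hollow_involutions_def)
qed

section \<open>Rank one matrices and the scaling path\<close>

definition outer :: "complex^'m \<Rightarrow> complex^'m \<Rightarrow> complex^'m^'m" where
  "outer v w = (\<chi> i j. v $ i * cnj (w $ j))"

lemma outer_vec: "outer v w *v x = cdot x w *s v"
  by (simp add: vec_eq_iff outer_def matrix_vector_mult_def cdot_def sum_distrib_left algebra_simps)

lemma path_componentI:
  fixes f :: "real \<Rightarrow> 'a::topological_space"
  assumes "continuous_on {0..1} f" "\<And>t. t \<in> {0..1} \<Longrightarrow> f t \<in> X"
  shows "path_component X (f 0) (f 1)"
  unfolding path_component_def using assms
  by (intro exI[of _ f]) (auto simp: path_def path_image_def pathstart_def pathfinish_def)

text \<open>The operator that acts on the system as \<open>u\<close> does, but with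
  \<open>t * l i\<close> for \<open>l i\<close>. The entrywise form reduces continuity in
  \<open>t\<close> to scalar functions.\<close>

definition dihedral_path ::
  "nat \<Rightarrow> (nat \<times> bool \<Rightarrow> complex^'m) \<Rightarrow> (nat \<Rightarrow> real) \<Rightarrow> real \<Rightarrow> complex^'m^'m" where
  "dihedral_path k g l t = (\<chi> x y. \<Sum>(i, b)\<in>pair_index k.
     of_real (sgn_bool b * (t * l i)) * outer (g (i, b)) (g (i, b)) $ x $ y
     + of_real (sqrt (1 - (t * l i)\<^sup>2)) * outer (g (i, \<not> b)) (g (i, b)) $ x $ y)"

lemma continuous_dihedral_path: "continuous_on A (dihedral_path k g l)"
  unfolding dihedral_path_def case_prod_unfold
  by (intro continuous_intros continuous_on_vec_lambda)

lemma conj_transpose_dihedral_path: "conj_transpose (dihedral_path k g l t) = dihedral_path k g l t"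
  unfolding conj_transpose_def dihedral_path_def
  by (simp add: vec_eq_iff sum_pair_index outer_def algebra_simps)

lemma dihedral_path_vec:
  "dihedral_path k g l t *v x = (\<Sum>(i, b)\<in>pair_index k.
     of_real (sgn_bool b * (t * l i)) *s (cdot x (g (i, b)) *s g (i, b))
     + of_real (sqrt (1 - (t * l i)\<^sup>2)) *s (cdot x (g (i, b)) *s g (i, \<not> b)))"
proof -
  have "dihedral_path k g l t *v x = (\<Sum>p\<in>pair_index k. (case p of (i, b) \<Rightarrow>
     (of_real (sgn_bool b * (t * l i)) *s (outer (g (i, b)) (g (i, b)) *v x)
     + of_real (sqrt (1 - (t * l i)\<^sup>2)) *s (outer (g (i, \<not> b)) (g (i, b)) *v x))))"
    unfolding vec_eq_iff dihedral_path_def case_prod_unfold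
    by (simp add: matrix_vector_mult_def sum_distrib_right sum_distrib_left sum.distrib
        algebra_simps sum.swap[of _ UNIV "pair_index k"])
  then show ?thesis by (simp add: outer_vec)
qed

lemma dihedral_path_basis:
  assumes "orthonormal (pair_index k) g" "i < k"
  shows "dihedral_path k g l t *v g (i, b) =
    of_real (sgn_bool b * (t * l i)) *s g (i, b)
      + of_real (sqrt (1 - (t * l i)\<^sup>2)) *s g (i, \<not> b)"
proof -
  have p: "(i, b) \<in> pair_index k" using assms by (simp add: pair_index_def)
  have cd: "cdot (g (i, b)) (g q) = (if q = (i, b) then 1 else 0)" if "q \<in> pair_index k" for q
    using assms(1) p that by (auto simp: orthonormal_def)
  have "dihedral_path k g l t *v g (i, b) = (\<Sum>p\<in>pair_index k. if p = (i, b) then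
      of_real (sgn_bool b * (t * l i)) *s g (i, b)
      + of_real (sqrt (1 - (t * l i)\<^sup>2)) *s g (i, \<not> b) else 0)"
    unfolding dihedral_path_vec
  proof (intro sum.cong refl)
    fix q assume "q \<in> pair_index k"
    then show "(case q of (j, c) \<Rightarrow>
        of_real (sgn_bool c * (t * l j)) *s (cdot (g (i, b)) (g (j, c)) *s g (j, c))
        + of_real (sqrt (1 - (t * l j)\<^sup>2)) *s (cdot (g (i, b)) (g (j, c)) *s g (j, \<not> c))) =
      (if q = (i, b) then of_real (sgn_bool b * (t * l i)) *s g (i, b)
        + of_real (sqrt (1 - (t * l i)\<^sup>2)) *s g (i, \<not> b) else 0)"
      by (cases "q = (i, b)"; cases q) (auto simp: cd smult_simps simp del: sgn_bool_simps)
  qed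
  also have "\<dots> = of_real (sgn_bool b * (t * l i)) *s g (i, b)
      + of_real (sqrt (1 - (t * l i)\<^sup>2)) *s g (i, \<not> b)"
    using p by simp
  finally show ?thesis .
qed

lemma matrix_eq_on_basis:
  fixes A B :: "complex^'m^'m"
  assumes "orthonormal (pair_index k) g" "orth_compl (pair_index k) g \<subseteq> {0}"
    and "\<And>i b. i < k \<Longrightarrow> A *v g (i, b) = B *v g (i, b)"
  shows "A = B"
proof -
  have "A *v x = B *v x" for x
    using assms(3)
    by (subst (1 2) orthonormal_expansion[OF finite_pair_index assms(1,2)])
      (auto simp: matrix_vector_sum matrix_vector_smult pair_index_def intro!: sum.cong)
  then show ?thesis by (simp add: matrix_eq)
qed

lemma path_component_odd:
  fixes u :: "complex^'m^'m" and S :: "'m::finite set"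
  assumes u: "u \<in> hollow_involutions" and S: "CARD('m) = 2 * card S"
  shows "\<exists>s\<in>odd_involutions S. path_component hollow_involutions u s"
proof -
  define J :: "complex^'m^'m" where "J = sgn_mat S"
  have J: "sa_involution J" "trace J = 0" unfolding J_def
    using sa_involution_sgn_mat trace_sgn_mat[OF S] by auto
  have u': "sa_involution u" "trace u = 0" using u by (auto simp: hollow_involutions_def trace_def)
  obtain k g l
    where sys: "dihedral_system J u k g l" and complete: "orth_compl (pair_index k) g \<subseteq> {0}"
    using complete_dihedral_system[OF J(1) u'(1) J(2) u'(2)] by blast
  have on: "orthonormal (pair_index k) g" and l1: "\<And>i. i < k \<Longrightarrow> \<bar>l i\<bar> \<le> 1"
    using sys by (auto simp: dihedral_system_def dihedral_pair_def)
  note eqI = matrix_eq_on_basis[OF on complete]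
  let ?D = "dihedral_path k g l"
  note D = dihedral_path_basis[OF on] and Jg = dihedral_system_J[OF sys]
  have D1: "?D 1 = u" by (rule eqI) (simp add: D dihedral_system_u[OF sys])
  have invol: "sa_involution (?D t)" if t: "t \<in> {0..1}" for t
    unfolding sa_involution_def
  proof
    show "conj_transpose (?D t) = ?D t" by (rule conj_transpose_dihedral_path)
    show "?D t ** ?D t = mat 1"
    proof (rule eqI)
      fix i b assume i: "i < k"
      \<comment> \<open>This keeps the radicand nonnegative, so the root squares back to it and each
        block squares to the identity.\<close>
      have "\<bar>t * l i\<bar> \<le> 1" using t l1[OF i] by (simp add: abs_mult mult_le_one)
      then have "(t * l i)\<^sup>2 \<le> 1" by (simp add: abs_square_le_1)
      then have "sqrt (1 - (t * l i)\<^sup>2) * sqrt (1 - (t * l i)\<^sup>2) = 1 - (t * l i)\<^sup>2" by simp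
      then have sq: "complex_of_real (sqrt (1 - (t * l i)\<^sup>2)) * complex_of_real (sqrt (1 - (t * l i)\<^sup>2)) =
          1 - (of_real t * of_real (l i))\<^sup>2"
        by (metis of_real_1 of_real_diff of_real_mult of_real_power)
      show "(?D t ** ?D t) *v g (i, b) = mat 1 *v g (i, b)"
        by (simp add: D[OF i] mv_simps smult_simps sq flip: matrix_vector_mul_assoc)
          (cases b; simp add: vec_eq_iff algebra_simps power2_eq_square)
    qed
  qed
  have scale: "(c *\<^sub>R A) *v x = of_real c *s (A *v x)" for c :: real and A :: "complex^'m^'m" and x
    by (simp add: vec_eq_iff matrix_vector_mult_def sum_distrib_left)
      (simp add: scaleR_conv_of_real mult.assoc)
  \<comment> \<open>Conjugation by \<open>J\<close> negates the terms exchanging the two vectors of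
    a pair, so only the terms linear in \<open>t\<close> survive in the sum.\<close>
  have even: "J ** ?D t ** J + ?D t = t *\<^sub>R (J ** u ** J + u)" for t
  proof (rule eqI)
    fix i b assume i: "i < k"
    show "(J ** ?D t ** J + ?D t) *v g (i, b) = (t *\<^sub>R (J ** u ** J + u)) *v g (i, b)"
      by (simp add: scale D[OF i] dihedral_system_u[OF sys i] Jg[OF i] mv_simps smult_simps
          flip: matrix_vector_mul_assoc) (simp add: vec_eq_iff algebra_simps)
  qed
  \<comment> \<open>\<open>J\<close> is diagonal with entries of square \<open>1\<close>. Together
    with \<open>even\<close>, the diagonal of \<open>?D t\<close> is \<open>t\<close> times that of
    \<open>u\<close>.\<close>
  have diag: "(J ** A ** J) $ i $ i = A $ i $ i" for A i
    by (simp add: J_def sgn_mat_mult_left sgn_mat_mult_right)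
  have hollow_involutions: "?D t \<in> hollow_involutions" if "t \<in> {0..1}" for t
  proof -
    have "?D t $ i $ i = 0" for i
    proof -
      have "(J ** ?D t ** J + ?D t) $ i $ i = 0"
        unfolding even using u by (simp add: diag hollow_involutions_def)
      then show ?thesis by (simp add: diag)
    qed
    with invol[OF that] show ?thesis by (simp add: hollow_involutions_def)
  qed
  \<comment> \<open>At \<open>t = 0\<close> each block merely exchanges two vectors with opposite
    \<open>J\<close>-eigenvalues.\<close>
  have "J ** ?D 0 = - (?D 0 ** J)"
    by (rule eqI) (simp add: D Jg mv_simps smult_simps flip: matrix_vector_mul_assoc)
  then have "?D 0 \<in> odd_involutions S"
    using invol[of 0] by (simp add: odd_involutions_def J_def)
  moreover have "path_component hollow_involutions (?D 0) (?D 1)"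
    using continuous_dihedral_path hollow_involutions by (rule path_componentI)
  ultimately show ?thesis unfolding D1 by (blast intro: path_component_sym)
qed

section \<open>Complex reflections\<close>

text \<open>For nonzero \<open>v\<close>, the operator multiplying \<open>v\<close> by
  \<open>w\<close> and fixing the vectors orthogonal to \<open>v\<close>; dividing by the squared
  norm spares normalising \<open>v\<close>.\<close>

definition reflection :: "complex^'m \<Rightarrow> complex \<Rightarrow> complex^'m^'m" where
  "reflection v w = (\<chi> x y. mat 1 $ x $ y + (w - 1) / of_real ((norm v)\<^sup>2) * outer v v $ x $ y)"

lemma reflection_vec:
  "reflection v w *v x = x + ((w - 1) / of_real ((norm v)\<^sup>2) * cdot x v) *s v"
proof -
  have "reflection v w *v x = mat 1 *v x + ((w - 1) / of_real ((norm v)\<^sup>2)) *s (outer v v *v x)"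
    unfolding vec_eq_iff reflection_def
    by (simp add: matrix_vector_mult_def sum_distrib_left sum.distrib algebra_simps)
  then show ?thesis by (simp add: outer_vec smult_simps)
qed

lemma conj_transpose_reflection: "conj_transpose (reflection v w) = reflection v (cnj w)"
  by (simp add: conj_transpose_def reflection_def outer_def mat_def vec_eq_iff mult.commute)

lemma reflection_cancel:
  assumes "v \<noteq> 0" "w * w' = 1"
  shows "reflection v w ** reflection v w' = mat 1"
proof -
  define N where "N = complex_of_real ((norm v)\<^sup>2)"
  have N: "N \<noteq> 0" "cdot v v = N" using assms by (auto simp: N_def cdot_self)
  have "(reflection v w ** reflection v w') *v x = x" for x
  proof -
    define b where "b = (w' - 1) / N * cdot x v"
    have R: "reflection v a *v y = y + ((a - 1) / N * cdot y v) *s v" for a y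
      by (simp add: reflection_vec N_def)
    have "b + (w - 1) / N * (cdot x v + b * N) = 0"
      using N(1) assms(2) by (simp add: b_def field_simps)
    then have "(b + (w - 1) / N * (cdot x v + b * N)) *s v = 0" by simp
    then show ?thesis
      unfolding matrix_vector_mul_assoc[symmetric] R b_def[symmetric] cdot_simps N(2)
      by (simp only: smult_simps add.assoc add_0_right)
  qed
  then show ?thesis by (simp add: matrix_eq)
qed

lemma reflection_one: "reflection v 1 = mat 1"
  by (simp add: reflection_def vec_eq_iff)

text \<open>A single complex reflection along \<open>e - d\<close> moves the unit vector \<open>e\<close> to \<open>d\<close>, whatever the
  phase of \<open>cdot e d\<close>: its unimodular parameter absorbs that phase.\<close>

lemma reflection_moves:
  assumes "norm e = 1" "norm d = 1" "e \<noteq> d"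
  obtains w where "norm w = 1" "reflection (e - d) w *v e = d"
proof -
  define z where "z = cdot e (e - d)"
  have ee: "cdot e e = 1" "cdot d d = 1" using assms by (simp_all add: cdot_self)
  \<comment> \<open>For unit vectors \<open>z = 1 - cdot e d\<close>, and the squared distance is
    twice its real part.\<close>
  have "cdot (e - d) (e - d) = z + cnj z"
    by (simp add: z_def cdot_simps ee cnj_cdot)
  then have N: "of_real ((norm (e - d))\<^sup>2) = z + cnj z" by (simp only: cdot_self)
  then have nz: "z + cnj z \<noteq> 0"
    using assms(3) by (metis of_real_eq_0_iff norm_eq_zero power_eq_0_iff right_minus_eq)
  then have z: "z \<noteq> 0" by auto
  \<comment> \<open>Solved from the condition that the coefficient of \<open>e - d\<close> in the
    image of \<open>e\<close> be \<open>-1\<close>.\<close>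
  define w where "w = - cnj z / z"
  have "(w - 1) / (z + cnj z) * z = - 1"
  proof -
    have "w - 1 = - (z + cnj z) / z" using z by (simp add: w_def field_simps)
    then show ?thesis using z nz by (simp add: divide_simps)
  qed
  then have "reflection (e - d) w *v e = d"
    unfolding reflection_vec N z_def[symmetric] by (simp add: smult_simps)
  moreover have "norm w = 1" using z by (simp add: w_def norm_divide)
  ultimately show thesis using that by blast
qed

section \<open>Conjugating odd involutions by reflections\<close>

lemma continuous_matrix_mult:
  fixes f :: "'a::topological_space \<Rightarrow> complex^'n^'m" and g :: "'a \<Rightarrow> complex^'p^'n"
  assumes "continuous_on A f" "continuous_on A g"
  shows "continuous_on A (\<lambda>x. f x ** g x)"
  unfolding matrix_matrix_mult_def
  by (intro continuous_on_vec_lambda continuous_intros assms)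

lemma sgn_mat_axis: "sgn_mat S *v axis j 1 = of_real (sgn_bool (j \<in> S)) *s axis j 1"
  by (simp add: vec_eq_iff sgn_mat_vec) (simp add: axis_def)

text \<open>\<open>sgn_mat S\<close> is self-adjoint and fixes \<open>v\<close>, so it preserves the
  component along \<open>v\<close>.\<close>

lemma reflection_commutes_sgn_mat:
  assumes "sgn_mat S *v v = v"
  shows "sgn_mat S ** reflection v w = reflection v w ** sgn_mat S"
proof -
  have "sgn_mat S *v (reflection v w *v x) = reflection v w *v (sgn_mat S *v x)" for x
    using assms by (simp add: reflection_vec mv_simps sa_involution_cdot[OF sa_involution_sgn_mat])
  then show ?thesis by (simp add: matrix_eq flip: matrix_vector_mul_assoc)
qed

text \<open>Anticommuting with \<open>sgn_mat S\<close>, \<open>s\<close> exchanges its eigenspaces,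
  so the columns outside \<open>S\<close> are even vectors.\<close>

lemma odd_involution_axis:
  assumes s: "s \<in> odd_involutions S" and j: "j \<notin> S"
  shows "sgn_mat S *v (s *v axis j 1) = s *v axis j 1"
proof -
  have "(sgn_mat S ** s) *v axis j 1 = (- (s ** sgn_mat S)) *v axis j 1"
    using s by (simp add: odd_involutions_def)
  then show ?thesis
    using j by (simp add: mv_simps sgn_mat_axis smult_simps flip: matrix_vector_mul_assoc)
qed

lemma norm_sa_involution: "sa_involution u \<Longrightarrow> norm (u *v x) = norm x"
  by (simp add: norm_eq_sqrt_inner sa_involution_isometry flip: Re_cdot)

text \<open>The reflection is unitary with inverse \<open>reflection v (cnj w)\<close> and commutes
  with \<open>sgn_mat S\<close>, so conjugation preserves all the defining conditions.\<close>

lemma odd_involution_conj_reflection: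
  assumes s: "s \<in> odd_involutions S" and v: "sgn_mat S *v v = v" "v \<noteq> 0" and w: "norm w = 1"
  shows "reflection v w ** s ** reflection v (cnj w) \<in> odd_involutions S"
proof -
  let ?R = "reflection v w" and ?R' = "reflection v (cnj w)" and ?J = "sgn_mat S"
  have s': "sa_involution s" "?J ** s = - (s ** ?J)" using s by (auto simp: odd_involutions_def)
  have "w * cnj w = 1" using w by (simp add: complex_norm_square[symmetric])
  then have RR: "?R ** ?R' = mat 1" "?R' ** ?R = mat 1"
    by (auto intro!: reflection_cancel[OF v(2)] simp: mult.commute)
  have "conj_transpose (?R ** s ** ?R') = ?R ** s ** ?R'"
    using s'(1) by (simp add: conj_transpose_mult conj_transpose_reflection sa_involution_def
        matrix_mul_assoc)
  moreover have "?R ** s ** ?R' ** (?R ** s ** ?R') = ?R ** (s ** (?R' ** ?R) ** s) ** ?R'"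
    by (simp add: matrix_mul_assoc)
  then have "?R ** s ** ?R' ** (?R ** s ** ?R') = mat 1"
    using s'(1) by (simp add: RR sa_involution_def)
  moreover have "?J ** (?R ** s ** ?R') = - (?R ** s ** ?R' ** ?J)"
  proof -
    have neg: "A ** (- B) = - (A ** B)" "(- A) ** B = - (A ** B)" for A B :: "complex^'a^'a"
      by (simp_all add: vec_eq_iff matrix_matrix_mult_def sum_negf)
    have "?J ** (?R ** s ** ?R') = ?R ** (?J ** s) ** ?R'"
      by (metis matrix_mul_assoc reflection_commutes_sgn_mat[OF v(1)])
    also have "\<dots> = - (?R ** s ** (?J ** ?R'))" by (simp add: s' neg matrix_mul_assoc)
    also have "\<dots> = - (?R ** s ** ?R' ** ?J)"
      by (simp add: reflection_commutes_sgn_mat[OF v(1)] matrix_mul_assoc)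
    finally show ?thesis .
  qed
  ultimately show ?thesis by (simp add: odd_involutions_def sa_involution_def)
qed

lemma path_component_conj_reflection:
  assumes s: "s \<in> odd_involutions S" and v: "sgn_mat S *v v = v" "v \<noteq> 0" and w: "norm w = 1"
  shows "path_component (odd_involutions S) s (reflection v w ** s ** reflection v (cnj w))"
proof -
  \<comment> \<open>The path runs the parameter along the unit circle from \<open>1\<close>, where
    the reflection is the identity, to \<open>w\<close>.\<close>
  obtain a where a: "w = cis a" using w by (metis complex_norm_eq_1_exp cis_conv_exp)
  define f where "f t = reflection v (cis (t * a)) ** s ** reflection v (cnj (cis (t * a)))" for t
  have "continuous_on {0..1} f"
    unfolding f_def reflection_def divide_inverse
    by (intro continuous_matrix_mult continuous_on_vec_lambda continuous_intros)
  moreover have "f t \<in> odd_involutions S" for t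
    unfolding f_def using odd_involution_conj_reflection[OF s v] by simp
  ultimately have "path_component (odd_involutions S) (f 0) (f 1)" by (intro path_componentI)
  then show ?thesis by (simp add: f_def a reflection_one)
qed

text \<open>Columns are corrected one at a time by a reflection along \<open>e - d\<close>, the
  difference between the present and the desired column. This vector is even and orthogonal to the
  columns already correct, so those are not disturbed.\<close>

lemma odd_involution_prescribe_columns:
  fixes S F :: "'m::finite set" and s :: "complex^'m^'m"
  assumes s: "s \<in> odd_involutions S" and sig: "\<sigma> ` (- S) \<subseteq> S" "inj_on \<sigma> (- S)" and "F \<subseteq> - S"
  shows "\<exists>s'. path_component (odd_involutions S) s s' \<and> (\<forall>j\<in>F. s' *v axis j 1 = axis (\<sigma> j) 1)"
  using finite[of F] \<open>F \<subseteq> - S\<close>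
proof (induction F rule: finite_induct)
  case empty
  then show ?case using s path_component_refl by auto
next
  case (insert j F)
  then obtain r where r: "path_component (odd_involutions S) s r"
    "\<forall>i\<in>F. r *v axis i 1 = axis (\<sigma> i) 1"
    by auto
  have ro: "r \<in> odd_involutions S" and ri: "sa_involution r"
    using path_component_mem(2)[OF r(1)] by (auto simp: odd_involutions_def)
  define e where "e = r *v axis j 1"
  define d :: "complex^'m" where "d = axis (\<sigma> j) 1"
  show ?case
  proof (cases "e = d")
    case True
    then show ?thesis using r unfolding e_def d_def by auto
  next
    case False
    have norms: "norm e = 1" "norm d = 1" by (simp_all add: e_def d_def norm_sa_involution[OF ri])
    have "\<sigma> j \<in> S" using insert.prems sig by auto
    then have J: "sgn_mat S *v (e - d) = e - d"
      using odd_involution_axis[OF ro] insert.prems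
      by (simp add: e_def d_def mv_simps sgn_mat_axis smult_simps)
    obtain w where w: "norm w = 1" "reflection (e - d) w *v e = d"
      using reflection_moves[OF norms False] by blast
    let ?R = "reflection (e - d)"
    define r' where "r' = ?R w ** r ** ?R (cnj w)"
    have "path_component (odd_involutions S) r r'"
      unfolding r'_def using path_component_conj_reflection[OF ro J _ w(1)] False by simp
    then have "path_component (odd_involutions S) s r'" using r(1) path_component_trans by blast
    \<comment> \<open>For \<open>i\<close> outside \<open>S\<close> the axis vector is odd, hence
      orthogonal to the even vector \<open>e - d\<close>. The right factor of \<open>r'\<close>
      therefore leaves it alone.\<close>
    moreover have fix_even: "?R c *v axis i 1 = axis i 1" if "i \<notin> S" for i c
    proof -
      have "cdot (sgn_mat S *v axis i 1) (sgn_mat S *v (e - d)) = cdot (axis i 1) (e - d)"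
        by (rule sa_involution_isometry[OF sa_involution_sgn_mat])
      then have "cdot (axis i 1) (e - d) = 0"
        unfolding J using that by (simp add: sgn_mat_axis smult_simps cdot_minus_left)
      then show ?thesis by (simp add: reflection_vec)
    qed
    have "r' *v axis j 1 = d"
      using insert.prems w(2) fix_even
        unfolding r'_def by (simp add: e_def flip: matrix_vector_mul_assoc)
    moreover have "r' *v axis i 1 = axis (\<sigma> i) 1" if i: "i \<in> F" for i
    proof -
      have ne: "i \<noteq> j" "\<sigma> i \<noteq> \<sigma> j" using i insert sig(2) by (auto simp: inj_on_def)
      \<comment> \<open>An earlier column is orthogonal to \<open>e\<close> because \<open>r\<close>
        is an isometry, and to \<open>d\<close> because \<open>\<sigma>\<close> is
        injective.\<close>
      have "cdot (r *v axis i 1) e = cdot (axis i 1) (axis j 1)"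
        unfolding e_def by (rule sa_involution_isometry[OF ri])
      then have "cdot (axis (\<sigma> i) 1) e = 0" using r(2) i ne by (simp add: cdot_axis_axis)
      moreover have "cdot (axis (\<sigma> i) 1) d = 0" using ne by (simp add: d_def cdot_axis_axis)
      ultimately have "?R w *v axis (\<sigma> i) 1 = axis (\<sigma> i) 1"
        by (simp add: reflection_vec cdot_simps)
      then show ?thesis
        using i r(2) insert.prems fix_even
          unfolding r'_def by (simp add: subset_iff flip: matrix_vector_mul_assoc)
    qed
    ultimately show ?thesis unfolding d_def by blast
  qed
qed

text \<open>Every odd involution is joined to the permutation matrix that exchanges \<open>j\<close>
  and \<open>\<sigma> j\<close> for all \<open>j\<close> outside \<open>S\<close>.\<close>

lemma path_connected_odd_involutions:
  fixes S :: "'m::finite set"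
  assumes S: "CARD('m) = 2 * card S"
  shows "path_connected (odd_involutions S)"
  unfolding path_connected_component
proof (intro ballI)
  fix s t assume st: "s \<in> odd_involutions S" "t \<in> odd_involutions S"
  have "card (- S) = card S" using S by (simp add: Compl_eq_Diff_UNIV card_Diff_subset)
  then obtain \<sigma> where bij: "bij_betw \<sigma> (- S) S" by (metis finite finite_same_card_bij)
  then have sig: "\<sigma> ` (- S) \<subseteq> S" "inj_on \<sigma> (- S)" by (auto simp: bij_betw_def)
  obtain s' where s': "path_component (odd_involutions S) s s'"
    "\<forall>j\<in>-S. s' *v axis j 1 = axis (\<sigma> j) 1"
    using odd_involution_prescribe_columns[OF st(1) sig order_refl] by blast
  obtain t' where t': "path_component (odd_involutions S) t t'"
    "\<forall>j\<in>-S. t' *v axis j 1 = axis (\<sigma> j) 1"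
    using odd_involution_prescribe_columns[OF st(2) sig order_refl] by blast
  have inv: "sa_involution s'" "sa_involution t'"
    using path_component_mem(2)[OF s'(1)] path_component_mem(2)[OF t'(1)]
      by (auto simp: odd_involutions_def)
  have "s' *v axis j 1 = t' *v axis j 1" for j
  proof (cases "j \<in> S")
    case True
    \<comment> \<open>An involution taking \<open>axis i 1\<close> to \<open>axis j 1\<close> takes
      \<open>axis j 1\<close> back, so the columns outside \<open>S\<close> determine those in
      \<open>S\<close>.\<close>
    then obtain i where i: "i \<in> - S" "j = \<sigma> i" using bij by (auto simp: bij_betw_def)
    then have "s' *v (s' *v axis i 1) = s' *v axis j 1" "t' *v (t' *v axis i 1) = t' *v axis j 1"
      using s'(2) t'(2) by auto
    then show ?thesis by (simp add: inv sa_involution_twice)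
  next
    case False
    then show ?thesis using s'(2) t'(2) by simp
  qed
  then have "s' = t'" by (rule matrix_eq_columns)
  then show "path_component (odd_involutions S) s t"
    using s'(1) t'(1) path_component_sym path_component_trans by blast
qed

section \<open>Joining the paths and returning to projections\<close>

lemma path_connected_hollow_involutions:
  assumes "CARD('m::finite) = 2 * n"
  shows "path_connected (hollow_involutions :: (complex^'m^'m) set)"
  unfolding path_connected_component
proof (intro ballI)
  fix u v :: "complex^'m^'m" assume uv: "u \<in> hollow_involutions" "v \<in> hollow_involutions"
  obtain S :: "'m set" where "card S = n"
    using assms obtain_subset_with_card_n[of n "UNIV :: 'm set"] by auto
  then have S: "CARD('m) = 2 * card S" using assms by simp
  obtain s t where s: "s \<in> odd_involutions S" "path_component hollow_involutions u s"
    and t: "t \<in> odd_involutions S" "path_component hollow_involutions v t"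
    using path_component_odd[OF uv(1) S] path_component_odd[OF uv(2) S] by blast
  have "path_component hollow_involutions s t"
    using path_connected_odd_involutions[OF S] s t path_component_of_subset[OF odd_involutions_subset]
    unfolding path_connected_component by blast
  then show "path_component hollow_involutions u v"
    using s t path_component_sym path_component_trans by metis
qed

theorem theorem1p1:
  fixes n :: nat
  assumes "n \<ge> 1"
    and "CARD('m::finite) = 2 * n"
  shows "path_connected {p :: complex^'m^'m. is_projection p \<and> (\<forall>i. p $ i $ i = 1/2)}"
proof -
  \<comment> \<open>The inverse of passing from \<open>p\<close> to \<open>2 p - 1\<close>.\<close>
  define f :: "complex^'m^'m \<Rightarrow> complex^'m^'m" where "f u = (1/2) *\<^sub>R (mat 1 + u)" for u
  have half: "((c::real) *\<^sub>R A) ** (d *\<^sub>R B) = (c * d) *\<^sub>R (A ** B)"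
    for A B :: "complex^'m^'m" and c d
    by (simp add: vec_eq_iff matrix_matrix_mult_def scaleR_sum_right mult.commute)
  have dist: "(A + B) ** C = A ** C + B ** C" for A B C :: "complex^'m^'m"
    by (simp add: vec_eq_iff matrix_matrix_mult_def distrib_right sum.distrib)
  have ct: "conj_transpose (mat 1 + u) = mat 1 + conj_transpose u"
    "conj_transpose (c *\<^sub>R u) = c *\<^sub>R conj_transpose u" for u :: "complex^'m^'m" and c
    by (auto simp: vec_eq_iff conj_transpose_def mat_def)
  have proj: "is_projection (f u) \<longleftrightarrow> sa_involution u" for u
  proof -
    \<comment> \<open>With \<open>mat 1\<close> for \<open>a\<close> and \<open>u ** u\<close> for
      \<open>b\<close>, this shows that \<open>f u\<close> fails to be idempotent exactly by a
      quarter of \<open>u ** u - mat 1\<close>.\<close>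
    have "(1/4) *\<^sub>R (a + 2 *\<^sub>R u + b) = (1/2) *\<^sub>R (a + u) + (1/4) *\<^sub>R (b - a)" for a b
      by (simp add: vec_eq_iff) (simp add: scaleR_conv_of_real field_simps)
    moreover have "f u ** f u = (1/4) *\<^sub>R (mat 1 + 2 *\<^sub>R u + u ** u)"
      unfolding f_def half by (simp add: matrix_add_ldistrib dist scaleR_2)
    ultimately have "f u ** f u = f u + (1/4) *\<^sub>R (u ** u - mat 1)"
      by (simp only: f_def)
    then have "f u = f u ** f u \<longleftrightarrow> u ** u = mat 1" by simp
    moreover have "f u = conj_transpose (f u) \<longleftrightarrow> conj_transpose u = u"
      unfolding f_def ct by (simp add: eq_commute[of u])
    ultimately show ?thesis by (simp only: is_projection_def sa_involution_def)
  qed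
  have diag: "f u $ i $ i = 1/2 \<longleftrightarrow> u $ i $ i = 0" for u i
  proof -
    have "f u $ i $ i = (1/2) *\<^sub>R (1 + u $ i $ i)" by (simp add: f_def mat_def)
    then show ?thesis by (simp add: scaleR_conv_of_real field_simps)
  qed
  have "{p :: complex^'m^'m. is_projection p \<and> (\<forall>i. p $ i $ i = 1/2)} = f ` hollow_involutions"
  proof (intro equalityI subsetI)
    fix p :: "complex^'m^'m" assume p: "p \<in> {p. is_projection p \<and> (\<forall>i. p $ i $ i = 1/2)}"
    define u where "u = 2 *\<^sub>R p - mat 1"
    have fu: "f u = p" by (simp add: f_def u_def)
    have "u \<in> hollow_involutions"
      using p proj[of u] diag[of u] by (simp add: fu hollow_involutions_def)
    then show "p \<in> f ` hollow_involutions" using fu by blast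
  next
    fix p assume "p \<in> f ` hollow_involutions"
    then obtain u where "p = f u" "u \<in> hollow_involutions" by blast
    then show "p \<in> {p. is_projection p \<and> (\<forall>i. p $ i $ i = 1/2)}"
      by (simp only: hollow_involutions_def proj diag mem_Collect_eq simp_thms)
  qed
  moreover have "continuous_on hollow_involutions f" unfolding f_def by (intro continuous_intros)
  ultimately show ?thesis
    using path_connected_hollow_involutions[OF assms(2)] by (simp add: path_connected_continuous_image)
qed

end
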